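(* Consider the regularized online allocation problem and the Dual Mirror Descent Algorithm $A$ described in the context, and suppose the assumptions on the requests, on the regularizer and on the reference function given there are satisfied. Suppose there exist a finite $\alpha\ge1$ and $p\in\partial r(0)$ such that for any $\mu\in\mathcal D$ $$\sup_{(f,b,\mathcal X)\in\mathcal S}\ \sup_{x\in\mathcal X}\big\{(\mu+p)^\top b(x)\big\}+r(0)\le\alpha\, r^*(-\mu).$$ Let the algorithm be run with step-size $\eta>0$ and initial solution $\mu_0\in\mathcal D$. Then for any $T\ge1$ and any request sequence $\vec\gamma\in\mathcal S^T$, $$\mathrm{OPT}(\vec\gamma)-\alpha R(A|\vec\gamma)\le C_1+C_2\,\eta\,T+\frac{C_3}{\eta},$$ where $\underline\rho=\min_{j\in[m]}\rho_j$, $C_1=\bar b\,(\bar f+\bar r+\alpha L(\bar b+\bar a)+2\alpha\|p\|_1\bar b)/\underline\rho$, $C_2=\alpha(\bar b+\bar a)^2/(2\sigma)$, and $C_3=\alpha\sup\{V_h(\mu,\mu_0):\mu\in\mathcal D,\ \|\mu\|_1\le L+C_1/(\alpha\bar b)\}$.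
   Context: Problem. There are $T$ time periods, $m$ resources, and a vector $\rho\in\mathbb R^m$ with positive entries; $T\rho$ is the total amount of resources. A request is a triple $\gamma=(f,b,\mathcal X)$ with decision set $\mathcal X\subset\mathbb R^d_+$ (possibly non-convex), reward function $f:\mathcal X\to\mathbb R_+$ (possibly non-concave) and consumption function $b:\mathcal X\to\mathbb R^m_+$ (possibly non-linear), with $0\in\mathcal X$ and $b(0)=0$. $\mathcal S$ is the set of all possible requests. Vector inequalities are coordinate-wise. $r:\{a\in\mathbb R^m:a\le\rho\}\to\mathbb R$ is the regularizer. For a sequence $\vec\gamma=(\gamma_1,\dots,\gamma_T)\in\mathcal S^T$, $\gamma_t=(f_t,b_t,\mathcal X_t)$, $$\mathrm{OPT}(\vec\gamma)=\max_{x_t\in\mathcal X_t}\ \sum_{t=1}^T f_t(x_t)+T\,r\Big(\tfrac1T\sum_{t=1}^T b_t(x_t)\Big)\quad\text{s.t. }\sum_{t=1}^T b_t(x_t)\le T\rho .$$ If an online algorithm $A$ takes actions $x_t$, its regularized reward is $R(A|\vec\gamma)=\sum_{t=1}^T f_t(x_t)+T\,r(\frac1T\sum_{t=1}^T b_t(x_t))$. Dual objects. $r^*(-\mu)=\sup_{a\le\rho}\{r(a)+\mu^\top a\}$ and $\mathcal D=\{\mu\in\mathbb R^m: r^*(-\mu)<+\infty\}$. $\partial r(0)$ is the superdifferential of the concave function $r$ at $0$, i.e. $p\in\partial r(0)$ iff $r(a)\le r(0)+p^\top a$ for all $a$ in the domain of $r$. Assumptions on the requests. There are $\bar f,\bar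 b\in\mathbb R_+$ such that for all $(f,b,\mathcal X)\in\mathcal S$ and $x\in\mathcal X$: $0\le f(x)\le\bar f$, $b(x)\ge0$, $\|b(x)\|_\infty\le\bar b$. Assumptions on the regularizer. (1) $|r(a_1)-r(a_2)|\le L\|a_1-a_2\|_\infty$ for all $a_1,a_2\le\rho$; (2) there is $\bar a$ such that for any $\mu\in\mathcal D$ there exists $a\in\arg\max_{a\le\rho}\{r(a)+\mu^\top a\}$ with $\|a\|_\infty\le\bar a$; (3) there is $\bar r$ with $0\le r(a)\le\bar r$ for all $0\le a\le\rho$; (4) $r$ is concave. Assumptions on the reference function $h:\mathbb R^m\to\mathbb R$. $h$ is either differentiable or essentially smooth in $\mathcal D$, and $h$ is $\sigma$-strongly convex ($\sigma>0$) in the $\ell_1$-norm on $\mathcal D$: $h(\mu_1)\ge h(\mu_2)+\langle\nabla h(\mu_2),\mu_1-\mu_2\rangle+\frac\sigma2\|\mu_1-\mu_2\|_1^2$ for all $\mu_1,\mu_2\in\mathcal D$. The Bregman divergence is $V_h(x,y)=h(x)-h(y)-\nabla h(y)^\top(x-y)$. Dual Mirror Descent Algorithm. Inputs: $\mu_0\in\mathcal D$, $T$, $h$, step-size $\eta$. Start with current dual variable $\mu_1:=\mu_0$ and remaining resources $B_1=T\rho$. For $t=1,\dots,T$: receive $(f_t,b_t,\mathcal X_t)$; compute $\tilde x_t\in\arg\max_{x\in\mathcal X_t}\{f_t(x)-\mu_t^\top b_t(x)\}$ (maximizers are assumed to exist); set $x_t=\tilde x_t$ if $b_t(\tilde x_t)\le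 B_t$ and $x_t=0$ otherwise; set $B_{t+1}=B_t-b_t(x_t)$; choose $a_t\in\arg\max_{a\le\rho}\{r(a)+\mu_t^\top a\}$ with $\|a_t\|_\infty\le\bar a$; set $\tilde g_t=-b_t(x_t)+a_t$; update $\mu_{t+1}=\arg\min_{\mu\in\mathcal D}\{\langle\tilde g_t,\mu\rangle+\frac1\eta V_h(\mu,\mu_t)\}$. In the expression $C_1/(\alpha\bar b)$ the factor $\bar b$ cancels against the one in $C_1$. *)

theory Defs
  imports "HOL-Analysis.Analysis"
begin

definition l1_norm :: "real ^ 'm \<Rightarrow> real" where
  "l1_norm x = (\<Sum>j\<in>UNIV. \<bar>x $ j\<bar>)"

text \<open>Only the values of reward and consumption on the decision set matter.\<close>

record ('d, 'm) request =
  reward :: "real ^ 'd::finite \<Rightarrow> real"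
  consumption :: "real ^ 'd::finite \<Rightarrow> real ^ 'm::finite"
  decisions :: "(real ^ 'd::finite) set"

definition request_assms ::
  "('d::finite, 'm::finite) request set \<Rightarrow> real \<Rightarrow> real \<Rightarrow> bool" where
  "request_assms S fbar bbar \<longleftrightarrow>
     0 \<le> fbar \<and> 0 \<le> bbar \<and>
     (\<forall>q\<in>S. 0 \<in> decisions q \<and> consumption q 0 = 0 \<and>
        (\<forall>x\<in>decisions q. 0 \<le> x \<and>
           0 \<le> reward q x \<and> reward q x \<le> fbar \<and>
           0 \<le> consumption q x \<and> infnorm (consumption q x) \<le> bbar))"


text \<open>
  The regularizer is a function on \<open>{a. a \<le> \<rho>}\<close>; its values elsewhere are never used.
  In particular \<open>reg_conj \<rho> r (- \<mu>)\<close> is the supremum of \<open>r a + \<mu> \<bullet> a\<close> over \<open>a \<le> \<rho>\<close>.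
\<close>

definition reg_conj :: "real ^ 'm \<Rightarrow> (real ^ 'm \<Rightarrow> real) \<Rightarrow> real ^ 'm \<Rightarrow> ereal" where
  "reg_conj \<rho> r \<nu> = (SUP a\<in>{a. a \<le> \<rho>}. ereal (r a - \<nu> \<bullet> a))"

definition dual_dom :: "real ^ 'm \<Rightarrow> (real ^ 'm \<Rightarrow> real) \<Rightarrow> (real ^ 'm) set" where
  "dual_dom \<rho> r = {\<mu>. reg_conj \<rho> r (- \<mu>) < \<infinity>}"

definition superdifferential ::
  "real ^ 'm \<Rightarrow> (real ^ 'm \<Rightarrow> real) \<Rightarrow> real ^ 'm \<Rightarrow> (real ^ 'm) set" where
  "superdifferential \<rho> r a0 = {p. \<forall>a. a \<le> \<rho> \<longrightarrow> r a \<le> r a0 + p \<bullet> (a - a0)}"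

definition regularizer_assms ::
  "real ^ 'm \<Rightarrow> (real ^ 'm \<Rightarrow> real) \<Rightarrow> real \<Rightarrow> real \<Rightarrow> real \<Rightarrow> bool" where
  "regularizer_assms \<rho> r L abar rbar \<longleftrightarrow>
     (\<forall>a1 a2. a1 \<le> \<rho> \<longrightarrow> a2 \<le> \<rho> \<longrightarrow> \<bar>r a1 - r a2\<bar> \<le> L * infnorm (a1 - a2)) \<and>
     (\<forall>\<mu>\<in>dual_dom \<rho> r.
        \<exists>a. is_arg_max (\<lambda>a. r a + \<mu> \<bullet> a) (\<lambda>a. a \<le> \<rho>) a \<and> infnorm a \<le> abar) \<and>
     (\<forall>a. 0 \<le> a \<longrightarrow> a \<le> \<rho> \<longrightarrow> 0 \<le> r a \<and> r a \<le> rbar) \<and>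
     concave_on {a. a \<le> \<rho>} r"


definition grad :: "(real ^ 'm \<Rightarrow> real) \<Rightarrow> real ^ 'm \<Rightarrow> real ^ 'm" where
  "grad h y = (THE g. GDERIV h y :> g)"

text \<open>
  Essential smoothness in the sense of Rockafellar (Convex Analysis, Section 26) of the convex
  function that equals \<open>h\<close> on \<open>D\<close> and is infinite elsewhere.
\<close>

definition essentially_smooth_on :: "(real ^ 'm) set \<Rightarrow> (real ^ 'm \<Rightarrow> real) \<Rightarrow> bool" where
  "essentially_smooth_on D h \<longleftrightarrow>
     convex_on D h \<and> interior D \<noteq> {} \<and>
     (\<forall>x\<in>interior D. h differentiable (at x)) \<and>
     (\<forall>s x. (\<forall>n. s n \<in> interior D) \<longrightarrow> s \<longlonglongrightarrow> x \<longrightarrow> x \<in> frontier (interior D) \<longrightarrow>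
        filterlim (\<lambda>n. norm (grad h (s n))) at_top sequentially)"

text \<open>
  An essentially smooth function has no gradient on the boundary of \<open>D\<close>. The strong convexity
  inequality is therefore required at the points \<open>\<mu>2\<close> of \<open>D\<close> at which the gradient exists, and
  the Bregman divergence from a point without gradient is infinite, which is the usual convention.
  If \<open>h\<close> is differentiable at all points of \<open>D\<close>, neither clause plays a role.
\<close>

definition reference_assms :: "(real ^ 'm) set \<Rightarrow> (real ^ 'm \<Rightarrow> real) \<Rightarrow> real \<Rightarrow> bool" where
  "reference_assms D h \<sigma> \<longleftrightarrow>
     ((\<forall>\<mu>\<in>D. h differentiable (at \<mu>)) \<or> essentially_smooth_on D h) \<and>
     \<sigma> > 0 \<and>
     (\<forall>\<mu>1\<in>D. \<forall>\<mu>2\<in>D. h differentiable (at \<mu>2) \<longrightarrow>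
        h \<mu>1 \<ge> h \<mu>2 + grad h \<mu>2 \<bullet> (\<mu>1 - \<mu>2) + \<sigma> / 2 * (l1_norm (\<mu>1 - \<mu>2))\<^sup>2)"

definition bregman :: "(real ^ 'm \<Rightarrow> real) \<Rightarrow> real ^ 'm \<Rightarrow> real ^ 'm \<Rightarrow> ereal" where
  "bregman h x y =
     (if h differentiable (at y) then ereal (h x - h y - grad h y \<bullet> (x - y)) else \<infinity>)"


text \<open>Periods are \<open>1, \<dots>, T\<close>; sequences are functions on \<open>nat\<close>.\<close>

definition reg_reward ::
  "(real ^ 'm \<Rightarrow> real) \<Rightarrow> nat \<Rightarrow> (nat \<Rightarrow> ('d::finite, 'm::finite) request)
    \<Rightarrow> (nat \<Rightarrow> real ^ 'd) \<Rightarrow> real" where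
  "reg_reward r T \<gamma> x =
     (\<Sum>t=1..T. reward (\<gamma> t) (x t))
     + real T * r ((1 / real T) *\<^sub>R (\<Sum>t=1..T. consumption (\<gamma> t) (x t)))"

definition OPT ::
  "real ^ 'm \<Rightarrow> (real ^ 'm \<Rightarrow> real) \<Rightarrow> nat \<Rightarrow> (nat \<Rightarrow> ('d::finite, 'm::finite) request)
    \<Rightarrow> ereal" where
  "OPT \<rho> r T \<gamma> =
     (SUP x\<in>{x. (\<forall>t\<in>{1..T}. x t \<in> decisions (\<gamma> t)) \<and>
                (\<Sum>t=1..T. consumption (\<gamma> t) (x t)) \<le> real T *\<^sub>R \<rho>}.
        ereal (reg_reward r T \<gamma> x))"

text \<open>
  A run of dual mirror descent: dual iterates \<open>\<mu>\<close>, remaining resources \<open>B\<close>, tentative actions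
  \<open>xt\<close>, actions \<open>x\<close> and maximizers \<open>a\<close>. Ties between optimal solutions are broken arbitrarily.
\<close>

definition dual_mirror_descent_run ::
  "real ^ 'm \<Rightarrow> (real ^ 'm \<Rightarrow> real) \<Rightarrow> real \<Rightarrow> (real ^ 'm \<Rightarrow> real) \<Rightarrow> real \<Rightarrow> real ^ 'm \<Rightarrow> nat
    \<Rightarrow> (nat \<Rightarrow> ('d::finite, 'm::finite) request)
    \<Rightarrow> (nat \<Rightarrow> real ^ 'm) \<Rightarrow> (nat \<Rightarrow> real ^ 'm) \<Rightarrow> (nat \<Rightarrow> real ^ 'd) \<Rightarrow> (nat \<Rightarrow> real ^ 'd)
    \<Rightarrow> (nat \<Rightarrow> real ^ 'm) \<Rightarrow> bool" where
  "dual_mirror_descent_run \<rho> r abar h \<eta> \<mu>0 T \<gamma> \<mu> B xt x a \<longleftrightarrow>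
     \<mu> 1 = \<mu>0 \<and> B 1 = real T *\<^sub>R \<rho> \<and>
     (\<forall>t\<in>{1..T}.
        is_arg_max (\<lambda>y. reward (\<gamma> t) y - \<mu> t \<bullet> consumption (\<gamma> t) y)
          (\<lambda>y. y \<in> decisions (\<gamma> t)) (xt t) \<and>
        x t = (if consumption (\<gamma> t) (xt t) \<le> B t then xt t else 0) \<and>
        B (t + 1) = B t - consumption (\<gamma> t) (x t) \<and>
        is_arg_max (\<lambda>c. r c + \<mu> t \<bullet> c) (\<lambda>c. c \<le> \<rho>) (a t) \<and> infnorm (a t) \<le> abar \<and>
        is_arg_min
          (\<lambda>\<nu>. ereal ((- consumption (\<gamma> t) (x t) + a t) \<bullet> \<nu>)
                + ereal (1 / \<eta>) * bregman h \<nu> (\<mu> t))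
          (\<lambda>\<nu>. \<nu> \<in> dual_dom \<rho> r) (\<mu> (t + 1)))"

end

theory Submission
  imports Defs
begin

text \<open>
  Optimality of \<open>x\<^sub>t\<close> against both \<open>x\<^sub>t\<^sup>*\<close> and \<open>0\<close>, together with the hypothesis on \<open>\<alpha>\<close>, bounds
  \<open>f\<^sub>t(x\<^sub>t\<^sup>*) + p \<bullet> b\<^sub>t(x\<^sub>t\<^sup>*) + r(0)\<close> by \<open>\<alpha> (f\<^sub>t(x\<^sub>t) + r(a\<^sub>t) + \<mu>\<^sub>t \<bullet> g\<^sub>t)\<close> as long as no action has been
  rejected. Mirror descent replaces \<open>\<mu>\<^sub>t\<close> by a fixed comparison point \<open>\<nu>\<close>. The choice \<open>\<nu> = q\<close> with
  \<open>-q\<close> a supergradient of \<open>r\<close> at the average consumption turns \<open>\<Sum> r(a\<^sub>t) + \<nu> \<bullet> g\<^sub>t\<close> into \<open>T\<close> times \<open>r\<close> of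
  that average.
\<close>

section \<open>Duality between \<open>l1_norm\<close> and \<open>infnorm\<close>\<close>

lemma inner_le_infnorm_l1_norm: "x \<bullet> y \<le> infnorm x * l1_norm (y :: real ^ 'm)"
proof -
  have "x \<bullet> y \<le> (\<Sum>j\<in>UNIV. infnorm x * \<bar>y $ j\<bar>)"
    unfolding inner_vec_def
  proof (rule sum_mono)
    fix j
    have "x $ j * y $ j \<le> \<bar>x $ j\<bar> * \<bar>y $ j\<bar>"
      by (metis abs_ge_self abs_mult)
    also have "\<dots> \<le> infnorm x * \<bar>y $ j\<bar>"
      by (intro mult_right_mono component_le_infnorm_cart) auto
    finally show "x $ j \<bullet> y $ j \<le> infnorm x * \<bar>y $ j\<bar>" by simp
  qed
  then show ?thesis by (simp add: l1_norm_def sum_distrib_left)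
qed

lemma infnorm_le_cart: "infnorm (x :: real ^ 'm) \<le> c" if "\<And>j. \<bar>x $ j\<bar> \<le> c"
  unfolding infnorm_cart using that by (intro cSup_least) auto

lemma l1_norm_triangle: "l1_norm (x + y) \<le> l1_norm x + l1_norm y"
  unfolding l1_norm_def by (simp add: sum.distrib[symmetric] sum_mono abs_triangle_ineq)

lemma l1_norm_nonneg: "0 \<le> l1_norm x"
  unfolding l1_norm_def by (simp add: sum_nonneg)

lemma l1_norm_axis: "l1_norm (axis j c) = \<bar>c\<bar>"
proof -
  have "l1_norm (axis j c) = (\<Sum>i\<in>UNIV. if i = j then \<bar>c\<bar> else 0)"
    unfolding l1_norm_def axis_def by (intro sum.cong) auto
  then show ?thesis by simp
qed

text \<open>The sign vector of \<open>q\<close> has sup-norm at most 1 and its inner product with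
  \<open>q\<close> is exactly \<open>l1_norm q\<close>, so testing this single direction
  suffices.\<close>

lemma l1_norm_le_of_inner_le:
  assumes "0 \<le> L" and le: "\<And>d. q \<bullet> d \<le> L * infnorm d"
  shows "l1_norm (q :: real ^ 'm) \<le> L"
proof -
  define d :: "real ^ 'm" where "d = (\<chi> j. sgn (q $ j))"
  have "infnorm d \<le> 1"
    by (intro infnorm_le_cart) (simp add: d_def abs_sgn_eq)
  moreover have "q \<bullet> d = l1_norm q"
    unfolding inner_vec_def l1_norm_def d_def by (intro sum.cong) (auto simp: abs_sgn)
  ultimately show ?thesis
    using le[of d] mult_left_mono[of "infnorm d" 1 L] \<open>0 \<le> L\<close> by simp
qed

section \<open>Supergradients of bounded l1-norm for Lipschitz concave functions\<close>

text \<open>Separating the hypograph of \<open>r\<close> from the open cone with apex \<open>(c, r c)\<close> and slope \<open>L\<close> gives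
  a supergradient of norm at most \<open>L\<close> even at boundary points \<open>c\<close> of the domain.\<close>

lemma lipschitz_concave_supergradient:
  fixes r :: "real ^ 'm \<Rightarrow> real"
  assumes conc: "concave_on C r"
    and lip: "\<And>a b. a \<in> C \<Longrightarrow> b \<in> C \<Longrightarrow> \<bar>r a - r b\<bar> \<le> L * infnorm (a - b)"
    and "0 \<le> L" and c: "c \<in> C"
  obtains q where "l1_norm q \<le> L" and "\<And>a. a \<in> C \<Longrightarrow> r a + q \<bullet> a \<le> r c + q \<bullet> c"
proof -
  define H where "H = {z. fst z \<in> C \<and> snd z \<le> r (fst z)}"
  define U where "U = {z. snd z > r c + L * infnorm (fst z - c)}"
  have convH: "convex H"
  proof -
    have "convex_on C (\<lambda>a. - r a)" using conc by (simp add: concave_on_def)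
    then have "convex (epigraph C (\<lambda>a. - r a))"
      using conc by (intro convex_epigraphI concave_on_imp_convex)
    then have "convex ((\<lambda>z. (fst z, - snd z)) -` epigraph C (\<lambda>a. - r a))"
      by (intro convex_linear_vimage) (auto intro!: linearI simp: )
    also have "(\<lambda>z. (fst z, - snd z)) -` epigraph C (\<lambda>a. - r a) = H"
      by (auto simp: epigraph_def H_def)
    finally show ?thesis .
  qed
  have convU: "convex U"
  proof (rule convexI)
    fix x y :: "(real ^ 'm) \<times> real" and u v :: real
    assume x: "x \<in> U" and y: "y \<in> U" and uv: "0 \<le> u" "0 \<le> v" "u + v = 1"
    have "fst (u *\<^sub>R x + v *\<^sub>R y) - c = u *\<^sub>R (fst x - c) + v *\<^sub>R (fst y - c)"
      using uv by (simp add: algebra_simps flip: scaleR_add_left)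
    then have "infnorm (fst (u *\<^sub>R x + v *\<^sub>R y) - c) \<le> u * infnorm (fst x - c) + v * infnorm (fst y - c)"
      using infnorm_triangle[of "u *\<^sub>R (fst x - c)" "v *\<^sub>R (fst y - c)"] uv by (simp add: infnorm_mul)
    then have "r c + L * infnorm (fst (u *\<^sub>R x + v *\<^sub>R y) - c)
        \<le> (u + v) * r c + L * (u * infnorm (fst x - c) + v * infnorm (fst y - c))"
      using \<open>0 \<le> L\<close> uv by (simp add: mult_left_mono)
    also have "\<dots> = u * (r c + L * infnorm (fst x - c)) + v * (r c + L * infnorm (fst y - c))"
      by (simp add: algebra_simps)
    also have "\<dots> < u * snd x + v * snd y"
    proof (cases "u = 0")
      case True then show ?thesis using y uv by (simp add: U_def)
    next
      case False
      then show ?thesis using x y uv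
        by (intro add_less_le_mono mult_strict_left_mono mult_left_mono) (auto simp: U_def)
    qed
    finally show "u *\<^sub>R x + v *\<^sub>R y \<in> U" by (simp add: U_def)
  qed
  have "H \<inter> U = {}"
  proof (rule ccontr)
    assume "H \<inter> U \<noteq> {}"
    then obtain z where "z \<in> H" "z \<in> U" by blast
    then show False using lip[of "fst z" c] c by (auto simp: H_def U_def)
  qed
  moreover have "(c, r c) \<in> H" "(c, r c + 1) \<in> U" using c by (auto simp: H_def U_def infnorm_0)
  ultimately obtain w b where w: "w \<noteq> 0" "\<And>z. z \<in> H \<Longrightarrow> w \<bullet> z \<le> b" "\<And>z. z \<in> U \<Longrightarrow> b \<le> w \<bullet> z"
    using separating_hyperplane_sets[OF convH convU] by blast
  obtain q0 l where w_eq: "w = (q0, l)" by (cases w)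
  have low: "q0 \<bullet> a + l * s \<le> b" if "a \<in> C" "s \<le> r a" for a s
    using w(2)[of "(a, s)"] that by (simp add: H_def w_eq)
  have "q0 \<bullet> (c + d) + l * (r c + L * infnorm d + e) \<ge> b" if "e > 0" for d e
    using w(3)[of "(c + d, r c + L * infnorm d + e)"] that by (simp add: U_def w_eq)
  then have up: "q0 \<bullet> c + l * r c \<le> q0 \<bullet> (c + d) + l * (r c + L * infnorm d + e)" if "e > 0" for d e
    using low[OF c order.refl] that by (meson order.trans)
  have "0 \<le> l" using up[of 1 0] by (simp add: infnorm_0 algebra_simps)
  \<comment> \<open>The hyperplane is not vertical: \<open>U\<close> projects onto the whole space,
    so with \<open>l = 0\<close> the functional \<open>q0\<close> would be nonnegative in every
    direction, in particular in direction \<open>- q0\<close>.\<close>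
  have "l \<noteq> 0"
  proof
    assume "l = 0"
    then have "0 \<le> q0 \<bullet> (- q0)" using up[of 1 "- q0"] by (simp add: inner_simps)
    then have "q0 \<bullet> q0 \<le> 0" by simp
    then have "q0 \<bullet> q0 = 0" using inner_ge_zero order_antisym by blast
    then have "q0 = 0" by simp
    then show False using w(1) w_eq \<open>l = 0\<close> by (simp add: zero_prod_def)
  qed
  then have "l > 0" using \<open>0 \<le> l\<close> by simp
  \<comment> \<open>Letting the height above the cone tend to 0 leaves a bound on \<open>q0\<close>
    by the slope of the cone. Normalizing by \<open>l\<close> turns it into the norm bound for
    \<open>q\<close>.\<close>
  have up0: "0 \<le> q0 \<bullet> d + l * (L * infnorm d)" for d
  proof (rule field_le_epsilon)
    fix e :: real assume "e > 0"
    then show "0 \<le> q0 \<bullet> d + l * (L * infnorm d) + e"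
      using up[of "e / l" d] \<open>l > 0\<close> by (simp add: inner_simps algebra_simps)
  qed
  define q where "q = q0 /\<^sub>R l"
  have "l1_norm q \<le> L"
  proof (rule l1_norm_le_of_inner_le[OF \<open>0 \<le> L\<close>])
    fix d
    show "q \<bullet> d \<le> L * infnorm d"
      using up0[of "-d"] \<open>l > 0\<close> by (simp add: q_def infnorm_neg field_simps)
  qed
  moreover have "r a + q \<bullet> a \<le> r c + q \<bullet> c" if "a \<in> C" for a
  proof -
    have "q0 \<bullet> a + l * r a \<le> q0 \<bullet> c + l * r c"
    \<comment> \<open>The apex does not belong to the open set \<open>U\<close>, so the separation
      constant \<open>b\<close> is compared with its value there through points slightly above
      it.\<close>
    proof (rule field_le_epsilon)
      fix e :: real assume "e > 0"
      have "(c, r c + e / l) \<in> U" using \<open>e > 0\<close> \<open>l > 0\<close> by (simp add: U_def infnorm_0)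
      then have "b \<le> q0 \<bullet> c + l * (r c + e / l)" using w(3) by (force simp: w_eq)
      then show "q0 \<bullet> a + l * r a \<le> q0 \<bullet> c + l * r c + e"
        using low[OF that order.refl] \<open>l > 0\<close> by (simp add: algebra_simps)
    qed
    from mult_left_mono[OF this, of "inverse l"] show ?thesis
      using \<open>l > 0\<close> by (simp add: q_def distrib_left mult.assoc[symmetric])
  qed
  ultimately show ?thesis using that by blast
qed

section \<open>Gradients and essential smoothness\<close>

text \<open>\<open>grad\<close> is a definite description, so both existence and uniqueness are
  needed. The representing vector collects the values of the derivative on the basis.\<close>

lemma GDERIV_grad:
  fixes h :: "real ^ 'm \<Rightarrow> real"
  assumes "h differentiable (at y)"
  shows "GDERIV h y :> grad h y"
proof -
  obtain f' where f': "(h has_derivative f') (at y)" using assms by (auto simp: differentiable_def)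
  then interpret f': bounded_linear f' by (rule has_derivative_bounded_linear)
  define g where "g = (\<Sum>b\<in>Basis. f' b *\<^sub>R b)"
  have "f' v = v \<bullet> g" for v
  proof -
    have "f' v = f' (\<Sum>b\<in>Basis. (v \<bullet> b) *\<^sub>R b)" by (simp add: euclidean_representation)
    also have "\<dots> = v \<bullet> g" by (simp add: f'.sum f'.scaleR g_def inner_sum_right mult.commute)
    finally show ?thesis .
  qed
  then have g: "GDERIV h y :> g"
    using f' unfolding gderiv_def by (metis (no_types) ext)
  have "g' = g" if "GDERIV h y :> g'" for g'
  proof -
    have "(\<lambda>v. v \<bullet> g') = (\<lambda>v. v \<bullet> g)"
      using has_derivative_unique that g by (auto simp: gderiv_def)
    then show ?thesis by (metis inner_commute vector_eq_rdot)
  qed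
  then show ?thesis unfolding grad_def using g by (rule theI[rotated])
qed

text \<open>If \<open>h\<close> fell at a bounded rate on the way from the boundary point
  \<open>y\<close> to an interior point \<open>c\<close>, the gradient inequality at points of this
  segment, tested on a small sphere around \<open>c\<close>, would bound the gradients near
  \<open>y\<close>. Essential smoothness makes their norms tend to infinity instead.\<close>

lemma essentially_smooth_slope_unbounded:
  fixes h :: "real ^ 'm \<Rightarrow> real"
  assumes smooth: "essentially_smooth_on D h" and "convex D"
    and gradient_ineq: "\<And>x y. x \<in> D \<Longrightarrow> y \<in> interior D \<Longrightarrow> h y + grad h y \<bullet> (x - y) \<le> h x"
    and y: "y \<in> D" "y \<notin> interior D"
  obtains c where "c \<in> D" "\<And>M. \<exists>t>0. t \<le> 1 \<and> h (y + t *\<^sub>R (c - y)) < h y - M * t"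
proof -
  obtain c where c: "c \<in> interior D" using smooth by (auto simp: essentially_smooth_on_def)
  have "h differentiable (at c)" using smooth c by (auto simp: essentially_smooth_on_def)
  then have "isCont h c" by (rule differentiable_imp_continuous_within)
  then obtain e1 where e1: "e1 > 0" "\<And>x. dist x c < e1 \<Longrightarrow> dist (h x) (h c) < 1"
    unfolding continuous_at_eps_delta by (metis zero_less_one dist_norm real_norm_def dist_real_def)
  obtain e2 where e2: "e2 > 0" "ball c e2 \<subseteq> D" using c by (auto simp: mem_interior)
  \<comment> \<open>The sphere of radius \<open>e\<close> around \<open>c\<close> lies in
    \<open>D\<close>, and \<open>h\<close> stays below \<open>h c + 1\<close> on it.\<close>
  define e where "e = min e1 e2 / 2"
  have e: "0 < e" "e < e1" "e < e2" using e1(1) e2(1) by (auto simp: e_def)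
  \<comment> \<open>These points run along the segment from \<open>c\<close> (at
    \<open>n = 0\<close>) to \<open>y\<close>, and all of them are interior because \<open>c\<close>
    is.\<close>
  define s where "s = (\<lambda>n::nat. y - inverse (real (Suc n)) *\<^sub>R (y - c))"
  have s_int: "s n \<in> interior D" for n
    unfolding s_def using y c \<open>convex D\<close> closure_subset
    by (intro mem_interior_closure_convex_shrink) (auto simp: field_simps)
  have "s \<longlonglongrightarrow> y - 0 *\<^sub>R (y - c)"
    unfolding s_def by (intro tendsto_intros LIMSEQ_inverse_real_of_nat)
  then have "s \<longlonglongrightarrow> y" by simp
  moreover have "y \<in> frontier (interior D)"
    using y c closure_subset convex_closure_interior[OF \<open>convex D\<close>] by (auto simp: frontier_def)
  ultimately have blowup: "filterlim (\<lambda>n. norm (grad h (s n))) at_top sequentially"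
    using smooth s_int by (auto simp: essentially_smooth_on_def)
  have "\<exists>t>0. t \<le> 1 \<and> h (y + t *\<^sub>R (c - y)) < h y - M * t" for M
  proof (rule ccontr)
    assume "\<not> ?thesis"
    then have low: "h y - M * t \<le> h (y + t *\<^sub>R (c - y))" if "0 < t" "t \<le> 1" for t
      using that by force
    \<comment> \<open>The value of \<open>N\<close> is read off from the estimate of
      \<open>e * norm g\<close> reached at the end.\<close>
    define N where "N = max 0 ((h c + 1 - h y + 2 * \<bar>M\<bar>) / e)"
    have "eventually (\<lambda>n. N < norm (grad h (s n))) sequentially"
      using blowup by (simp add: filterlim_at_top_dense)
    then obtain n where n: "N < norm (grad h (s n))" by (auto simp: eventually_sequentially)
    define t where "t = inverse (real (Suc n))"
    define g where "g = grad h (s n)"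
    \<comment> \<open>Moving from \<open>c\<close> in the direction of the gradient itself makes the
      gradient inequality produce the term \<open>e * norm g\<close>.\<close>
    define x where "x = c + (e / norm g) *\<^sub>R g"
    have t: "0 < t" "t \<le> 1" by (auto simp: t_def field_simps)
    have "norm g > 0" using n by (simp add: g_def N_def)
    have sn: "s n = y + t *\<^sub>R (c - y)" by (simp add: s_def t_def algebra_simps)
    have "dist x c = e" using \<open>norm g > 0\<close> e by (simp add: x_def dist_norm)
    then have "x \<in> D" "h x < h c + 1"
      using e e1(2)[of x] e2(2) by (auto simp: dist_commute mem_ball dist_real_def)
    then have "h (s n) + g \<bullet> (x - s n) < h c + 1"
      using gradient_ineq[OF _ s_int[of n], of x] by (simp add: g_def)
    moreover have "g \<bullet> (x - s n) = (1 - t) * (g \<bullet> (c - y)) + e * norm g"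
    proof -
      have "x - s n = (1 - t) *\<^sub>R (c - y) + (e / norm g) *\<^sub>R g"
        by (simp add: x_def sn algebra_simps)
      then show ?thesis
        using \<open>norm g > 0\<close> by (simp add: inner_add_right power2_eq_square flip: power2_norm_eq_inner)
    qed
    ultimately have 1: "h (s n) + (1 - t) * (g \<bullet> (c - y)) + e * norm g < h c + 1" by simp
    have 2: "h y - M * t \<le> h (s n)" using low[OF t] by (simp add: sn)
    \<comment> \<open>The gradient inequality towards \<open>y\<close>, combined with the assumed
      bounded rate of decrease, bounds the slope of \<open>g\<close> in direction
      \<open>c - y\<close> from below by \<open>- M\<close>.\<close>
    have "h (s n) - t * (g \<bullet> (c - y)) \<le> h y"
      using gradient_ineq[OF y(1) s_int[of n]] by (simp add: g_def sn)
    with 2 have "t * (- M) \<le> t * (g \<bullet> (c - y))" by (simp add: algebra_simps)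
    then have "- M \<le> g \<bullet> (c - y)" using t(1) by (simp only: mult_le_cancel_left_pos)
    then have "(1 - t) * (- M) \<le> (1 - t) * (g \<bullet> (c - y))" using t by (intro mult_left_mono) auto
    with 1 2 have "h y - M + e * norm g < h c + 1" by (simp add: algebra_simps)
    then have "e * norm g < h c + 1 - h y + 2 * \<bar>M\<bar>" by simp
    then have "norm g < (h c + 1 - h y + 2 * \<bar>M\<bar>) / e" using e by (simp add: field_simps)
    also have "\<dots> \<le> N" by (simp add: N_def)
    finally show False using n by (simp add: g_def)
  qed
  moreover have "c \<in> D" using c interior_subset by blast
  ultimately show ?thesis using that by blast
qed

section \<open>Proximal steps and the regret of mirror descent\<close>

text \<open>Real-valued form of \<open>bregman\<close> for points \<open>y\<close> at which
  \<open>h\<close> is differentiable, so that the descent estimates stay within real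
  arithmetic.\<close>

definition bregman_fin :: "(real ^ 'm \<Rightarrow> real) \<Rightarrow> real ^ 'm \<Rightarrow> real ^ 'm \<Rightarrow> real" where
  "bregman_fin h x y = h x - h y - grad h y \<bullet> (x - y)"

lemma bregman_eq_fin: "h differentiable (at y) \<Longrightarrow> bregman h x y = ereal (bregman_fin h x y)"
  by (simp add: bregman_def bregman_fin_def)

lemma bregman_fin_ge:
  assumes "reference_assms D h \<sigma>" "x \<in> D" "y \<in> D" "h differentiable (at y)"
  shows "\<sigma> / 2 * (l1_norm (x - y))\<^sup>2 \<le> bregman_fin h x y"
proof -
  have "h y + grad h y \<bullet> (x - y) + \<sigma> / 2 * (l1_norm (x - y))\<^sup>2 \<le> h x"
    using assms unfolding reference_assms_def by blast
  then show ?thesis by (simp add: bregman_fin_def)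
qed

lemma prox_minimal:
  assumes \<eta>: "\<eta> > 0" and "h differentiable (at y)"
    and "is_arg_min (\<lambda>\<nu>. ereal (g \<bullet> \<nu>) + ereal (1 / \<eta>) * bregman h \<nu> y) (\<lambda>\<nu>. \<nu> \<in> D) z"
    and "x \<in> D"
  shows "\<eta> * (g \<bullet> z) + bregman_fin h z y \<le> \<eta> * (g \<bullet> x) + bregman_fin h x y"
proof -
  have "g \<bullet> z + bregman_fin h z y / \<eta> \<le> g \<bullet> x + bregman_fin h x y / \<eta>"
    using assms by (force simp: is_arg_min_def bregman_eq_fin)
  from mult_left_mono[OF this, of \<eta>] show ?thesis
    using \<eta> by (simp add: distrib_left)
qed

text \<open>Under essential smoothness a boundary point cannot be a minimizer, since \<open>h\<close> decreases there
  with infinite slope towards the interior.\<close>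

lemma prox_differentiable:
  fixes h :: "real ^ 'm \<Rightarrow> real"
  assumes ref: "reference_assms D h \<sigma>" and "convex D" and "\<eta> > 0"
    and y: "h differentiable (at y)"
    and z: "is_arg_min (\<lambda>\<nu>. ereal (g \<bullet> \<nu>) + ereal (1 / \<eta>) * bregman h \<nu> y) (\<lambda>\<nu>. \<nu> \<in> D) z"
  shows "h differentiable (at z)"
proof (rule ccontr)
  assume nd: "\<not> h differentiable (at z)"
  have zD: "z \<in> D" using z by (simp add: is_arg_min_def)
  then have smooth: "essentially_smooth_on D h" using nd ref by (auto simp: reference_assms_def)
  then have zi: "z \<notin> interior D" using nd by (auto simp: essentially_smooth_on_def)
  have "h y + grad h y \<bullet> (x - y) \<le> h x" if "x \<in> D" "y \<in> interior D" for x y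
  proof -
    have "h differentiable (at y)" using that smooth by (auto simp: essentially_smooth_on_def)
    then have "\<sigma> / 2 * (l1_norm (x - y))\<^sup>2 \<le> bregman_fin h x y"
      using that interior_subset by (intro bregman_fin_ge[OF ref]) auto
    moreover have "0 \<le> \<sigma> / 2 * (l1_norm (x - y))\<^sup>2" using ref by (simp add: reference_assms_def)
    ultimately show ?thesis by (simp add: bregman_fin_def)
  qed
  then obtain c where c: "c \<in> D" "\<And>M. \<exists>t>0. t \<le> 1 \<and> h (z + t *\<^sub>R (c - z)) < h z - M * t"
    using essentially_smooth_slope_unbounded[OF smooth \<open>convex D\<close> _ zD zi] by blast
  \<comment> \<open>\<open>M\<close> is the rate at which the linear part of the scaled proximal
    objective changes towards \<open>c\<close>. A decrease of \<open>h\<close> at a rate beyond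
    \<open>M\<close> contradicts the minimality of \<open>z\<close>.\<close>
  define M where "M = (\<eta> *\<^sub>R g - grad h y) \<bullet> (c - z)"
  obtain t where t: "0 < t" "t \<le> 1" "h (z + t *\<^sub>R (c - z)) < h z - M * t" using c(2) by blast
  define x where "x = z + t *\<^sub>R (c - z)"
  have "x = (1 - t) *\<^sub>R z + t *\<^sub>R c" by (simp add: x_def algebra_simps)
  then have "x \<in> D" using convexD[OF \<open>convex D\<close> zD c(1), of "1 - t" t] t by simp
  then have "\<eta> * (g \<bullet> z) + bregman_fin h z y \<le> \<eta> * (g \<bullet> x) + bregman_fin h x y"
    by (rule prox_minimal[OF \<open>\<eta> > 0\<close> y z])
  moreover have "\<eta> * (g \<bullet> x) - grad h y \<bullet> (x - y) = \<eta> * (g \<bullet> z) - grad h y \<bullet> (z - y) + M * t"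
    by (simp add: x_def M_def inner_simps algebra_simps)
  ultimately have "h z \<le> h x + M * t" unfolding bregman_fin_def by linarith
  then show False using t(3) by (simp add: x_def)
qed

lemma prox_first_order:
  fixes h :: "real ^ 'm \<Rightarrow> real"
  assumes "convex D" and "\<eta> > 0"
    and y: "h differentiable (at y)" and zd: "h differentiable (at z)"
    and z: "is_arg_min (\<lambda>\<nu>. ereal (g \<bullet> \<nu>) + ereal (1 / \<eta>) * bregman h \<nu> y) (\<lambda>\<nu>. \<nu> \<in> D) z"
    and x: "x \<in> D"
  shows "0 \<le> (\<eta> *\<^sub>R g + grad h z - grad h y) \<bullet> (x - z)"
proof (rule ccontr)
  assume neg: "\<not> ?thesis"
  \<comment> \<open>Up to an additive constant, this is \<open>\<eta>\<close> times the proximal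
    objective along the segment from \<open>z\<close> to \<open>x\<close>. A negative derivative at
    0 would yield a better point of \<open>D\<close> nearby.\<close>
  define \<phi> where "\<phi> = (\<lambda>t. \<eta> * (g \<bullet> (z + t *\<^sub>R (x - z))) + h (z + t *\<^sub>R (x - z))
      - grad h y \<bullet> (z + t *\<^sub>R (x - z)))"
  have "(h has_derivative (\<lambda>v. v \<bullet> grad h z)) (at (z + 0 *\<^sub>R (x - z)))"
    using GDERIV_grad[OF zd] by (simp add: gderiv_def)
  moreover have "((\<lambda>t. z + t *\<^sub>R (x - z)) has_derivative (\<lambda>t. t *\<^sub>R (x - z))) (at 0)"
    by (auto intro!: derivative_eq_intros)
  ultimately have "((\<lambda>t. h (z + t *\<^sub>R (x - z))) has_derivative (\<lambda>t. (t *\<^sub>R (x - z)) \<bullet> grad h z)) (at 0)"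
    by (rule has_derivative_compose[rotated, simplified o_def])
  then have "(\<phi> has_derivative (\<lambda>t. \<eta> * (g \<bullet> (t *\<^sub>R (x - z))) + (t *\<^sub>R (x - z)) \<bullet> grad h z
      - grad h y \<bullet> (t *\<^sub>R (x - z)))) (at 0)"
    unfolding \<phi>_def by (auto intro!: derivative_eq_intros)
  then have "(\<phi> has_real_derivative (\<eta> *\<^sub>R g + grad h z - grad h y) \<bullet> (x - z)) (at 0)"
    unfolding has_field_derivative_def
    by (rule has_derivative_eq_rhs) (simp add: fun_eq_iff inner_simps inner_commute algebra_simps)
  then obtain d where d: "d > 0" "\<And>t. 0 < t \<Longrightarrow> t < d \<Longrightarrow> \<phi> t < \<phi> 0"
    using DERIV_neg_dec_right[of \<phi> _ 0] neg by (metis add_0 not_le)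
  define t where "t = min (d / 2) 1"
  have t: "0 < t" "t < d" "t \<le> 1" using d(1) by (auto simp: t_def)
  define w where "w = z + t *\<^sub>R (x - z)"
  have "w = (1 - t) *\<^sub>R z + t *\<^sub>R x" by (simp add: w_def algebra_simps)
  moreover have "z \<in> D" using z by (simp add: is_arg_min_def)
  ultimately have "w \<in> D" using convexD[OF \<open>convex D\<close> _ x, of z "1 - t" t] t by simp
  then have "\<eta> * (g \<bullet> z) + bregman_fin h z y \<le> \<eta> * (g \<bullet> w) + bregman_fin h w y"
    by (rule prox_minimal[OF \<open>\<eta> > 0\<close> y z])
  then have "\<phi> 0 \<le> \<phi> t" by (simp add: \<phi>_def bregman_fin_def inner_diff_right flip: w_def)
  then show False using d(2)[OF t(1,2)] by simp
qed

text \<open>The part of \<open>g\<close> paired with \<open>z - x\<close> is controlled by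
  first-order optimality, the part paired with \<open>y - z\<close> by norm duality. The square of
  the step length arising in the latter is absorbed by strong convexity.\<close>

lemma prox_step:
  fixes h :: "real ^ 'm \<Rightarrow> real"
  assumes ref: "reference_assms D h \<sigma>" and D: "convex D" and \<eta>: "\<eta> > 0"
    and yD: "y \<in> D" and y: "h differentiable (at y)"
    and z: "is_arg_min (\<lambda>\<nu>. ereal (g \<bullet> \<nu>) + ereal (1 / \<eta>) * bregman h \<nu> y) (\<lambda>\<nu>. \<nu> \<in> D) z"
    and x: "x \<in> D"
  shows "g \<bullet> (y - x) \<le> \<eta> * (infnorm g)\<^sup>2 / (2 * \<sigma>) + (bregman_fin h x y - bregman_fin h x z) / \<eta>"
proof -
  have zd: "h differentiable (at z)" by (rule prox_differentiable[OF ref D \<eta> y z])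
  have zD: "z \<in> D" using z by (simp add: is_arg_min_def)
  have \<sigma>: "\<sigma> > 0" using ref by (simp add: reference_assms_def)
  define u where "u = l1_norm (z - y)"
  have "\<eta> * (g \<bullet> (z - x)) \<le> (grad h z - grad h y) \<bullet> (x - z)"
    using prox_first_order[OF D \<eta> y zd z x] by (simp add: inner_simps algebra_simps)
  \<comment> \<open>The three-point identity of Bregman divergences.\<close>
  also have "\<dots> = bregman_fin h x y - bregman_fin h x z - bregman_fin h z y"
    by (simp add: bregman_fin_def inner_simps algebra_simps)
  also have "\<dots> \<le> bregman_fin h x y - bregman_fin h x z - \<sigma> / 2 * u\<^sup>2"
    using bregman_fin_ge[OF ref zD yD y] by (simp add: u_def)
  finally have 1: "\<eta> * (g \<bullet> (z - x)) \<le> bregman_fin h x y - bregman_fin h x z - \<sigma> / 2 * u\<^sup>2" .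
  have "g \<bullet> (y - z) \<le> infnorm g * l1_norm (y - z)" by (rule inner_le_infnorm_l1_norm)
  also have "l1_norm (y - z) = u" by (simp add: u_def l1_norm_def abs_minus_commute)
  finally have "\<eta> * (g \<bullet> (y - z)) \<le> \<eta> * (infnorm g * u)" using \<eta> by simp
  \<comment> \<open>Young's inequality, weighted so that the quadratic term in \<open>u\<close>
    cancels the one in fact \<open>1\<close>.\<close>
  also have "\<dots> \<le> (\<eta> * infnorm g)\<^sup>2 / (2 * \<sigma>) + \<sigma> / 2 * u\<^sup>2"
  proof -
    have "0 \<le> (\<eta> * infnorm g - \<sigma> * u)\<^sup>2" by simp
    then show ?thesis using \<sigma> by (simp add: field_simps power2_eq_square)
  qed
  finally have "\<eta> * (g \<bullet> (y - x)) \<le> (\<eta> * infnorm g)\<^sup>2 / (2 * \<sigma>) + (bregman_fin h x y - bregman_fin h x z)"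
    using 1 by (simp add: inner_diff_right algebra_simps)
  then have "g \<bullet> (y - x) \<le> ((\<eta> * infnorm g)\<^sup>2 / (2 * \<sigma>) + (bregman_fin h x y - bregman_fin h x z)) / \<eta>"
    using \<eta> by (simp add: field_simps)
  also have "\<dots> = \<eta> * (infnorm g)\<^sup>2 / (2 * \<sigma>) + (bregman_fin h x y - bregman_fin h x z) / \<eta>"
    using \<eta> by (simp add: add_divide_distrib power2_eq_square)
  finally show ?thesis .
qed

text \<open>The divergences in \<open>prox_step\<close> telescope over the periods.\<close>

lemma mirror_descent_regret:
  fixes h :: "real ^ 'm \<Rightarrow> real" and \<mu> g :: "nat \<Rightarrow> real ^ 'm"
  assumes ref: "reference_assms D h \<sigma>" and D: "convex D" and \<eta>: "\<eta> > 0"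
    and start: "\<mu> 1 \<in> D" "h differentiable (at (\<mu> 1))"
    and step: "\<And>t. t \<in> {1..n} \<Longrightarrow>
      is_arg_min (\<lambda>\<nu>. ereal (g t \<bullet> \<nu>) + ereal (1 / \<eta>) * bregman h \<nu> (\<mu> t)) (\<lambda>\<nu>. \<nu> \<in> D) (\<mu> (t + 1))"
    and bound: "\<And>t. t \<in> {1..n} \<Longrightarrow> infnorm (g t) \<le> G"
    and x: "x \<in> D"
  shows "(\<Sum>t=1..n. g t \<bullet> (\<mu> t - x)) \<le> real n * (\<eta> * G\<^sup>2 / (2 * \<sigma>)) + bregman_fin h x (\<mu> 1) / \<eta>"
proof -
  have \<sigma>: "\<sigma> > 0" using ref by (simp add: reference_assms_def)
  define c where "c = \<eta> * G\<^sup>2 / (2 * \<sigma>)"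
  \<comment> \<open>Differentiability and membership of the next iterate belong to the invariant,
    since the next proximal step is taken from there.\<close>
  have "h differentiable (at (\<mu> (k + 1))) \<and> \<mu> (k + 1) \<in> D \<and>
      (\<Sum>t=1..k. g t \<bullet> (\<mu> t - x)) \<le> real k * c
        + (bregman_fin h x (\<mu> 1) - bregman_fin h x (\<mu> (k + 1))) / \<eta>" if "k \<le> n" for k
    using that
  proof (induction k)
    case 0 then show ?case using start by simp
  next
    case (Suc k)
    then have IH: "h differentiable (at (\<mu> (Suc k)))" "\<mu> (Suc k) \<in> D"
      "(\<Sum>t=1..k. g t \<bullet> (\<mu> t - x)) \<le> real k * c
        + (bregman_fin h x (\<mu> 1) - bregman_fin h x (\<mu> (Suc k))) / \<eta>" by auto
    have z: "is_arg_min (\<lambda>\<nu>. ereal (g (Suc k) \<bullet> \<nu>) + ereal (1 / \<eta>) * bregman h \<nu> (\<mu> (Suc k)))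
        (\<lambda>\<nu>. \<nu> \<in> D) (\<mu> (Suc k + 1))"
      using Suc.prems by (intro step) simp
    have "(infnorm (g (Suc k)))\<^sup>2 \<le> G\<^sup>2"
      using bound[of "Suc k"] Suc.prems by (intro power_mono) (auto simp: infnorm_pos_le)
    then have "\<eta> * (infnorm (g (Suc k)))\<^sup>2 / (2 * \<sigma>) \<le> c"
      using \<eta> \<sigma> by (simp add: c_def divide_right_mono)
    then have "g (Suc k) \<bullet> (\<mu> (Suc k) - x) \<le> c
        + (bregman_fin h x (\<mu> (Suc k)) - bregman_fin h x (\<mu> (Suc k + 1))) / \<eta>"
      using prox_step[OF ref D \<eta> IH(2,1) z x] by linarith
    then have "(\<Sum>t=1..Suc k. g t \<bullet> (\<mu> t - x)) \<le> real (Suc k) * c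
        + (bregman_fin h x (\<mu> 1) - bregman_fin h x (\<mu> (Suc k + 1))) / \<eta>"
      using IH(3) by (simp add: algebra_simps diff_divide_distrib)
    moreover have "\<mu> (Suc k + 1) \<in> D" using z by (simp add: is_arg_min_def)
    ultimately show ?case using prox_differentiable[OF ref D \<eta> IH(1) z] by blast
  qed
  from this[OF order.refl] have *: "h differentiable (at (\<mu> (n + 1)))" "\<mu> (n + 1) \<in> D"
    "(\<Sum>t=1..n. g t \<bullet> (\<mu> t - x)) \<le> real n * c
        + (bregman_fin h x (\<mu> 1) - bregman_fin h x (\<mu> (n + 1))) / \<eta>" by auto
  have "0 \<le> \<sigma> / 2 * (l1_norm (x - \<mu> (n + 1)))\<^sup>2" using \<sigma> by simp
  also have "\<dots> \<le> bregman_fin h x (\<mu> (n + 1))" by (rule bregman_fin_ge[OF ref x *(2,1)])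
  finally have "(bregman_fin h x (\<mu> 1) - bregman_fin h x (\<mu> (n + 1))) / \<eta> \<le> bregman_fin h x (\<mu> 1) / \<eta>"
    using \<eta> by (simp add: divide_right_mono)
  with *(3) show ?thesis by (simp add: c_def)
qed

section \<open>The dual domain and the conjugate\<close>

text \<open>Trades the extended-real supremum for a real upper bound, the form in which convexity
  and membership are proved.\<close>

lemma mem_dual_dom_iff:
  "\<mu> \<in> dual_dom \<rho> r \<longleftrightarrow> (\<exists>M. \<forall>a\<le>\<rho>. r a + \<mu> \<bullet> a \<le> M)"
proof
  assume "\<mu> \<in> dual_dom \<rho> r"
  then have fin: "reg_conj \<rho> r (- \<mu>) < \<infinity>" by (simp add: dual_dom_def)
  then obtain M where M: "reg_conj \<rho> r (- \<mu>) \<le> ereal M"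
    by (metis less_PInf_Ex_of_nat less_imp_le less_irrefl)
  have "r a + \<mu> \<bullet> a \<le> M" if "a \<le> \<rho>" for a
  proof -
    have "ereal (r a - (- \<mu>) \<bullet> a) \<le> reg_conj \<rho> r (- \<mu>)"
      unfolding reg_conj_def by (rule SUP_upper) (use that in auto)
    also note M
    finally show ?thesis by simp
  qed
  then show "\<exists>M. \<forall>a\<le>\<rho>. r a + \<mu> \<bullet> a \<le> M" by blast
next
  assume "\<exists>M. \<forall>a\<le>\<rho>. r a + \<mu> \<bullet> a \<le> M"
  then obtain M where "\<forall>a\<le>\<rho>. r a + \<mu> \<bullet> a \<le> M" ..
  then have "reg_conj \<rho> r (- \<mu>) \<le> ereal M" unfolding reg_conj_def by (intro SUP_least) auto
  then show "\<mu> \<in> dual_dom \<rho> r" by (auto simp: dual_dom_def intro: le_less_trans)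
qed

lemma convex_dual_dom: "convex (dual_dom (\<rho> :: real ^ 'm) r)"
proof (rule convexI)
  fix x y :: "real ^ 'm" and u v :: real
  assume "x \<in> dual_dom \<rho> r" "y \<in> dual_dom \<rho> r" and uv: "0 \<le> u" "0 \<le> v" "u + v = 1"
  then obtain M N where M: "\<And>a. a \<le> \<rho> \<Longrightarrow> r a + x \<bullet> a \<le> M" and N: "\<And>a. a \<le> \<rho> \<Longrightarrow> r a + y \<bullet> a \<le> N"
    by (auto simp: mem_dual_dom_iff)
  have "r a + (u *\<^sub>R x + v *\<^sub>R y) \<bullet> a \<le> u * M + v * N" if "a \<le> \<rho>" for a
  proof -
    have "r a + (u *\<^sub>R x + v *\<^sub>R y) \<bullet> a = (u + v) * r a + (u *\<^sub>R x + v *\<^sub>R y) \<bullet> a" using uv by simp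
    also have "\<dots> = u * (r a + x \<bullet> a) + v * (r a + y \<bullet> a)" by (simp add: inner_simps algebra_simps)
    also have "\<dots> \<le> u * M + v * N" using M N that uv by (intro add_mono mult_left_mono) auto
    finally show ?thesis .
  qed
  then show "u *\<^sub>R x + v *\<^sub>R y \<in> dual_dom \<rho> r" unfolding mem_dual_dom_iff by blast
qed

lemma reg_conj_arg_max:
  assumes "is_arg_max (\<lambda>c. r c + \<mu> \<bullet> c) (\<lambda>c. c \<le> \<rho>) a"
  shows "reg_conj \<rho> r (- \<mu>) = ereal (r a + \<mu> \<bullet> a)"
  unfolding reg_conj_def
proof (rule antisym)
  show "(SUP c\<in>{c. c \<le> \<rho>}. ereal (r c - (- \<mu>) \<bullet> c)) \<le> ereal (r a + \<mu> \<bullet> a)"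
    using assms by (intro SUP_least) (auto simp: is_arg_max_def not_less)
  have "ereal (r a + \<mu> \<bullet> a) = ereal (r a - (- \<mu>) \<bullet> a)" by simp
  also have "\<dots> \<le> (SUP c\<in>{c. c \<le> \<rho>}. ereal (r c - (- \<mu>) \<bullet> c))"
    by (rule SUP_upper) (use assms in \<open>auto simp: is_arg_max_def\<close>)
  finally show "ereal (r a + \<mu> \<bullet> a) \<le> (SUP c\<in>{c. c \<le> \<rho>}. ereal (r c - (- \<mu>) \<bullet> c))" .
qed

section \<open>Single-period inequality and invariants of a run\<close>

text \<open>Comparing \<open>x\<close> with the action 0 shows that its penalized reward is
  nonnegative, so multiplying it by \<open>\<alpha>\<close> cannot decrease it. Comparing
  \<open>x\<close> with \<open>y\<close> and adding the hypothesis \<open>sup\<close> cancels the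
  terms in \<open>\<mu>\<close> and the consumption of \<open>y\<close>.\<close>

lemma per_period_bound:
  assumes sup: "(SUP q\<in>S. SUP y\<in>decisions q. ereal ((\<mu> + p) \<bullet> consumption q y)) + ereal (r 0)
      \<le> ereal \<alpha> * reg_conj \<rho> r (- \<mu>)"
    and "\<alpha> \<ge> 1" and "q \<in> S" and "y \<in> decisions q"
    and zero: "0 \<in> decisions q" "consumption q 0 = 0" "0 \<le> reward q 0"
    and x: "is_arg_max (\<lambda>y. reward q y - \<mu> \<bullet> consumption q y) (\<lambda>y. y \<in> decisions q) x"
    and a: "is_arg_max (\<lambda>c. r c + \<mu> \<bullet> c) (\<lambda>c. c \<le> \<rho>) a"
  shows "reward q y + p \<bullet> consumption q y + r 0
    \<le> \<alpha> * (reward q x + r a + (a - consumption q x) \<bullet> \<mu>)"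
proof -
  have opt: "reward q z - \<mu> \<bullet> consumption q z \<le> reward q x - \<mu> \<bullet> consumption q x"
    if "z \<in> decisions q" for z
    using x that by (auto simp: is_arg_max_def not_less)
  have "0 \<le> reward q x - \<mu> \<bullet> consumption q x" using opt[OF zero(1)] zero by simp
  then have 1: "reward q x - \<mu> \<bullet> consumption q x \<le> \<alpha> * (reward q x - \<mu> \<bullet> consumption q x)"
    using \<open>\<alpha> \<ge> 1\<close> mult_right_mono[of 1 \<alpha>] by fastforce
  have "ereal ((\<mu> + p) \<bullet> consumption q y)
      \<le> (SUP q\<in>S. SUP y\<in>decisions q. ereal ((\<mu> + p) \<bullet> consumption q y))"
    using \<open>q \<in> S\<close> \<open>y \<in> decisions q\<close> by (meson SUP_upper SUP_upper2)
  then have "ereal ((\<mu> + p) \<bullet> consumption q y) + ereal (r 0) \<le> ereal \<alpha> * reg_conj \<rho> r (- \<mu>)"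
    using sup add_right_mono order.trans by blast
  then have "(\<mu> + p) \<bullet> consumption q y + r 0 \<le> \<alpha> * (r a + \<mu> \<bullet> a)"
    by (simp add: reg_conj_arg_max[OF a])
  with 1 opt[OF \<open>y \<in> decisions q\<close>] show ?thesis
    by (simp add: inner_simps inner_commute algebra_simps)
qed

lemma request_assmsD:
  assumes "request_assms S fbar bbar" "q \<in> S" "y \<in> decisions q"
  shows "0 \<le> reward q y" "reward q y \<le> fbar" "0 \<le> consumption q y $ j"
    "consumption q y $ j \<le> bbar" "infnorm (consumption q y) \<le> bbar"
proof -
  show "0 \<le> reward q y" "reward q y \<le> fbar" "0 \<le> consumption q y $ j"
    and *: "infnorm (consumption q y) \<le> bbar"
    using assms by (auto simp: request_assms_def less_eq_vec_def)
  show "consumption q y $ j \<le> bbar"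
    using component_le_infnorm_cart[of "consumption q y" j] * by linarith
qed

lemma dual_mirror_descent_decisions:
  assumes "request_assms S fbar bbar" "\<forall>t\<in>{1..T}. \<gamma> t \<in> S"
    and "dual_mirror_descent_run \<rho> r abar h \<eta> \<mu>0 T \<gamma> \<mu> B xt x a" and "t \<in> {1..T}"
  shows "x t \<in> decisions (\<gamma> t)"
proof -
  have "x t = (if consumption (\<gamma> t) (xt t) \<le> B t then xt t else 0)" "xt t \<in> decisions (\<gamma> t)"
    using assms(3,4) unfolding dual_mirror_descent_run_def is_arg_max_def by blast+
  moreover have "0 \<in> decisions (\<gamma> t)" using assms(1,2,4) by (auto simp: request_assms_def)
  ultimately show ?thesis by simp
qed

text \<open>The stock never becomes negative because a rejected action is replaced by 0, which
  consumes nothing.\<close>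

lemma dual_mirror_descent_resources:
  assumes "request_assms S fbar bbar" "\<forall>t\<in>{1..T}. \<gamma> t \<in> S" and \<rho>: "0 \<le> \<rho>"
    and run: "dual_mirror_descent_run \<rho> r abar h \<eta> \<mu>0 T \<gamma> \<mu> B xt x a" and "n \<le> T"
  shows "B (n + 1) = real T *\<^sub>R \<rho> - (\<Sum>t=1..n. consumption (\<gamma> t) (x t)) \<and> 0 \<le> B (n + 1)"
  using \<open>n \<le> T\<close>
proof (induction n)
  case 0
  then show ?case using run \<rho> by (auto simp: dual_mirror_descent_run_def less_eq_vec_def)
next
  case (Suc n)
  then have t: "Suc n \<in> {1..T}" by simp
  then have x: "x (Suc n) = (if consumption (\<gamma> (Suc n)) (xt (Suc n)) \<le> B (Suc n) then xt (Suc n) else 0)"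
    and B: "B (Suc n + 1) = B (Suc n) - consumption (\<gamma> (Suc n)) (x (Suc n))"
    using run unfolding dual_mirror_descent_run_def by blast+
  have "consumption (\<gamma> (Suc n)) 0 = 0" using assms(1,2) t by (auto simp: request_assms_def)
  then have "consumption (\<gamma> (Suc n)) (x (Suc n)) \<le> B (Suc n)" using x Suc by auto
  then have "0 \<le> B (Suc n + 1)" using B by (simp add: less_eq_vec_def)
  moreover have "B (Suc n + 1) = real T *\<^sub>R \<rho> - (\<Sum>t=1..Suc n. consumption (\<gamma> t) (x t))"
    unfolding B using Suc by simp
  ultimately show ?case by simp
qed

section \<open>Comparison with one feasible sequence of actions\<close>

text \<open>Rewards from the first rejection on, in period \<open>n + 1\<close>, are discarded; but then some resource
  \<open>j\<close> is nearly exhausted, and adding \<open>(K / \<alpha>) e\<^sub>j\<close> to the comparison point pays for the periods after \<open>n\<close>.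
  If \<open>h\<close> has no gradient at \<open>\<mu>0\<close>, the divergence is infinite and nothing is to be shown.\<close>

lemma regret_against_feasible:
  fixes \<rho> p \<mu>0 :: "real ^ 'm" and r h :: "real ^ 'm \<Rightarrow> real"
    and S :: "('d::finite, 'm::finite) request set" and \<gamma> :: "nat \<Rightarrow> ('d, 'm) request"
    and \<mu> B a :: "nat \<Rightarrow> real ^ 'm" and xt x y :: "nat \<Rightarrow> real ^ 'd"
  assumes \<rho>: "\<forall>j. 0 < \<rho> $ j"
    and req: "request_assms S fbar bbar"
    and reg: "regularizer_assms \<rho> r L abar rbar"
    and ref: "reference_assms (dual_dom \<rho> r) h \<sigma>"
    and \<alpha>: "\<alpha> \<ge> 1" and p: "p \<in> superdifferential \<rho> r 0"
    and sup: "\<forall>\<nu>\<in>dual_dom \<rho> r.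
           (SUP q\<in>S. SUP y\<in>decisions q. ereal ((\<nu> + p) \<bullet> consumption q y)) + ereal (r 0)
             \<le> ereal \<alpha> * reg_conj \<rho> r (- \<nu>)"
    and \<eta>: "\<eta> > 0" and \<mu>0: "\<mu>0 \<in> dual_dom \<rho> r"
    and T: "T \<ge> 1" and \<gamma>: "\<forall>t\<in>{1..T}. \<gamma> t \<in> S"
    and run: "dual_mirror_descent_run \<rho> r abar h \<eta> \<mu>0 T \<gamma> \<mu> B xt x a"
    and y: "\<forall>t\<in>{1..T}. y t \<in> decisions (\<gamma> t)"
      "(\<Sum>t=1..T. consumption (\<gamma> t) (y t)) \<le> real T *\<^sub>R \<rho>"
  defines "\<rho>min \<equiv> Min (range (\<lambda>j. \<rho> $ j))"
  defines "K \<equiv> (fbar + rbar + \<alpha> * L * (bbar + abar) + 2 * \<alpha> * l1_norm p * bbar) / \<rho>min"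
  obtains \<nu> where "\<nu> \<in> dual_dom \<rho> r" "l1_norm \<nu> \<le> L + K / \<alpha>"
    "ereal (reg_reward r T \<gamma> y - \<alpha> * reg_reward r T \<gamma> x)
      \<le> ereal (bbar * K + \<alpha> * (bbar + abar)\<^sup>2 / (2 * \<sigma>) * \<eta> * real T)
        + ereal (\<alpha> / \<eta>) * bregman h \<nu> \<mu>0"
proof -
  let ?D = "dual_dom \<rho> r"
  define b where "b = (\<lambda>t. consumption (\<gamma> t) (x t))"
  have \<rho>0: "0 \<le> \<rho>" using \<rho> by (auto simp: less_eq_vec_def less_imp_le)
  have lip: "\<And>u v. u \<le> \<rho> \<Longrightarrow> v \<le> \<rho> \<Longrightarrow> \<bar>r u - r v\<bar> \<le> L * infnorm (u - v)"
    and r_bd: "\<And>u. 0 \<le> u \<Longrightarrow> u \<le> \<rho> \<Longrightarrow> 0 \<le> r u \<and> r u \<le> rbar"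
    and conc: "concave_on {a. a \<le> \<rho>} r"
    using reg by (auto simp: regularizer_assms_def)
  have \<rho>min: "0 < \<rho>min" "\<And>j. \<rho>min \<le> \<rho> $ j" using \<rho> by (auto simp: \<rho>min_def)
  have \<sigma>: "\<sigma> > 0" using ref by (simp add: reference_assms_def)
  have bbar: "0 \<le> bbar" "0 \<le> fbar" using req by (auto simp: request_assms_def)
  have a_bd: "infnorm (a t) \<le> abar" if "t \<in> {1..T}" for t
    using run that by (auto simp: dual_mirror_descent_run_def)
  have abar: "0 \<le> abar" using a_bd[of 1] T infnorm_pos_le[of "a 1"] by force
  have rbar: "0 \<le> r 0" "r 0 \<le> rbar" using r_bd[of 0] \<rho>0 by auto
  \<comment> \<open>The sign of \<open>L\<close> follows from the Lipschitz bound between the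
    distinct points \<open>\<rho>\<close> and 0. \<open>undefined\<close> serves as an arbitrary
    index.\<close>
  have L: "0 \<le> L"
  proof -
    have "0 < \<bar>\<rho> $ undefined\<bar>" using \<rho> by (metis zero_less_abs_iff less_irrefl)
    then have "0 < infnorm (\<rho> - 0)" using component_le_infnorm_cart[of \<rho> undefined] by simp
    moreover have "0 \<le> L * infnorm (\<rho> - 0)" using lip[of \<rho> 0] \<rho>0 by (smt (verit) order.refl)
    ultimately show ?thesis by (simp add: zero_le_mult_iff)
  qed
  have p0: "0 \<le> l1_norm p" by (rule l1_norm_nonneg)
  have K_eq: "K * \<rho>min = fbar + rbar + \<alpha> * L * (bbar + abar) + 2 * \<alpha> * l1_norm p * bbar"
    using \<rho>min by (simp add: K_def)
  have K: "0 \<le> K" unfolding K_def using \<rho>min bbar rbar abar L p0 \<alpha> by simp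
  have x_dec: "x t \<in> decisions (\<gamma> t)" if "t \<in> {1..T}" for t
    by (rule dual_mirror_descent_decisions[OF req \<gamma> run that])
  have b_bd: "0 \<le> b t $ j" "b t $ j \<le> bbar" "infnorm (b t) \<le> bbar" if "t \<in> {1..T}" for t j
    using request_assmsD[OF req _ x_dec[OF that]] \<gamma> that by (auto simp: b_def)
  define av where "av = (1 / real T) *\<^sub>R (\<Sum>t=1..T. b t)"
  have sum_b: "(\<Sum>t=1..T. b t) = real T *\<^sub>R av" using T by (simp add: av_def)
  have "0 \<le> real T *\<^sub>R \<rho> - (\<Sum>t=1..T. b t)"
    using dual_mirror_descent_resources[OF req \<gamma> \<rho>0 run order.refl] unfolding b_def by metis
  then have "(\<Sum>t=1..T. b t) \<le> real T *\<^sub>R \<rho>" by (simp add: less_eq_vec_def)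
  then have av_le: "av \<le> \<rho>" using T unfolding sum_b by (simp add: less_eq_vec_def)
  have T_av: "real T * (av $ j) = (\<Sum>t=1..T. b t $ j)" for j
    using arg_cong[OF sum_b, of "\<lambda>v. v $ j"] by simp
  have av_bd: "0 \<le> av $ j" "av $ j \<le> bbar" for j
  proof -
    have "0 \<le> real T * (av $ j)" unfolding T_av using b_bd by (intro sum_nonneg)
    then show "0 \<le> av $ j" using T by (simp add: zero_le_mult_iff)
    have "real T * (av $ j) \<le> real T * bbar"
      unfolding T_av using sum_bounded_above[of "{1..T}" "\<lambda>t. b t $ j" bbar] b_bd by simp
    then show "av $ j \<le> bbar" using T by simp
  qed
  \<comment> \<open>\<open>av\<close> may lie on the boundary of the domain, when some resource is
    used up exactly; the separation argument still supplies \<open>q\<close> there.\<close>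
  obtain q where q: "l1_norm q \<le> L" "\<And>c. c \<le> \<rho> \<Longrightarrow> r c + q \<bullet> c \<le> r av + q \<bullet> av"
    using lipschitz_concave_supergradient[OF conc _ L, of av] lip av_le by auto

  \<comment> \<open>\<open>n\<close> counts the periods before the first replaced action. Both cases
    are merged here: without a replacement \<open>n = T\<close>, \<open>\<kappa> = 0\<close> and
    \<open>j\<close> is arbitrary; otherwise \<open>\<kappa> = K / \<alpha>\<close>.\<close>
  obtain n \<kappa> j where n: "n \<le> T" "\<And>t. t \<in> {1..n} \<Longrightarrow> x t = xt t"
    and \<kappa>: "0 \<le> \<kappa>" "\<kappa> \<le> K / \<alpha>"
    and gain: "\<alpha> * (\<kappa> * (real n * \<rho> $ j - (\<Sum>t=1..n. b t $ j))) \<le> bbar * K - real (T - n) * (K * \<rho>min)"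
  proof (cases "\<forall>t\<in>{1..T}. x t = xt t")
    case True
    show ?thesis by (rule that[of T 0 undefined]) (use True K \<alpha> bbar in auto)
  next
    case False
    define s where "s = (LEAST t. t \<in> {1..T} \<and> x t \<noteq> xt t)"
    have s: "s \<in> {1..T}" "x s \<noteq> xt s"
      using LeastI_ex[of "\<lambda>t. t \<in> {1..T} \<and> x t \<noteq> xt t"] False unfolding s_def by blast+
    have before: "x t = xt t" if "t \<in> {1..s - 1}" for t
      using not_less_Least[of t "\<lambda>t. t \<in> {1..T} \<and> x t \<noteq> xt t"] that s(1) unfolding s_def[symmetric]
      by auto
    have "\<not> consumption (\<gamma> s) (xt s) \<le> B s"
      using run s by (auto simp: dual_mirror_descent_run_def)
    \<comment> \<open>Some coordinate of the stock is exceeded by the tentative action. A single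
      request uses at most \<open>bbar\<close> of it, so less than \<open>bbar\<close> of resource
      \<open>j\<close> remains.\<close>
    then obtain j where j: "B s $ j < consumption (\<gamma> s) (xt s) $ j"
      by (auto simp: less_eq_vec_def not_le)
    have "xt s \<in> decisions (\<gamma> s)" using run s by (auto simp: dual_mirror_descent_run_def is_arg_max_def)
    then have "B s $ j < bbar" using request_assmsD(4)[OF req] \<gamma> s(1) j by (meson less_le_trans)
    moreover have "B s = real T *\<^sub>R \<rho> - (\<Sum>t=1..s - 1. b t)"
      using dual_mirror_descent_resources[OF req \<gamma> \<rho>0 run, of "s - 1"] s(1) by (auto simp: b_def)
    ultimately have "real T * \<rho> $ j - (\<Sum>t=1..s - 1. b t $ j) \<le> bbar" by simp
    \<comment> \<open>Splitting \<open>T\<close> into the \<open>s - 1\<close> earlier periods and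
      the rest credits at least \<open>\<rho>min\<close> to each remaining period.\<close>
    then have "real (s - 1) * \<rho> $ j - (\<Sum>t=1..s - 1. b t $ j) \<le> bbar - real (T - (s - 1)) * \<rho> $ j"
      using s(1) by (simp add: of_nat_diff algebra_simps)
    also have "\<dots> \<le> bbar - real (T - (s - 1)) * \<rho>min"
      using \<rho>min(2)[of j] by (simp add: mult_left_mono)
    finally have "K * (real (s - 1) * \<rho> $ j - (\<Sum>t=1..s - 1. b t $ j))
        \<le> K * (bbar - real (T - (s - 1)) * \<rho>min)" using K by (rule mult_left_mono)
    then have "\<alpha> * (K / \<alpha> * (real (s - 1) * \<rho> $ j - (\<Sum>t=1..s - 1. b t $ j)))
        \<le> bbar * K - real (T - (s - 1)) * (K * \<rho>min)"
      using \<alpha> by (simp add: algebra_simps)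
    then show ?thesis using before s(1) K \<alpha> by (intro that[of "s - 1" "K / \<alpha>" j]) auto
  qed

  define \<nu> where "\<nu> = q + axis j \<kappa>"
  \<comment> \<open>Points of the domain are bounded above but not below, so adding a multiple of a
    unit vector preserves finiteness of the supremum because \<open>\<kappa>\<close> is
    nonnegative.\<close>
  have \<nu>D: "\<nu> \<in> ?D"
    unfolding mem_dual_dom_iff
  proof (intro exI allI impI)
    fix c assume c: "c \<le> \<rho>"
    then have "\<kappa> * c $ j \<le> \<kappa> * \<rho> $ j" using \<kappa> by (auto simp: less_eq_vec_def mult_left_mono)
    then show "r c + \<nu> \<bullet> c \<le> r av + q \<bullet> av + \<kappa> * \<rho> $ j"
      using q(2)[OF c] by (simp add: \<nu>_def inner_add_left inner_axis' )
  qed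
  have \<nu>_norm: "l1_norm \<nu> \<le> L + K / \<alpha>"
    using l1_norm_triangle[of q "axis j \<kappa>"] q(1) \<kappa> by (simp add: \<nu>_def l1_norm_axis)

  have real_bound: "reg_reward r T \<gamma> y - \<alpha> * reg_reward r T \<gamma> x
      \<le> bbar * K + \<alpha> * (bbar + abar)\<^sup>2 / (2 * \<sigma>) * \<eta> * real T + \<alpha> * bregman_fin h \<nu> \<mu>0 / \<eta>"
    if diff: "h differentiable (at \<mu>0)"
  proof -
    define g where "g = (\<lambda>t. - b t + a t)"
    have regret: "(\<Sum>t=1..n. g t \<bullet> (\<mu> t - \<nu>))
        \<le> real n * (\<eta> * (bbar + abar)\<^sup>2 / (2 * \<sigma>)) + bregman_fin h \<nu> (\<mu> 1) / \<eta>"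
    proof (rule mirror_descent_regret[OF ref convex_dual_dom \<eta> _ _ _ _ \<nu>D])
      show "\<mu> 1 \<in> ?D" "h differentiable (at (\<mu> 1))"
        using run diff \<mu>0 by (auto simp: dual_mirror_descent_run_def)
      fix t assume "t \<in> {1..n}"
      then have t: "t \<in> {1..T}" using n by auto
      then show "is_arg_min (\<lambda>\<nu>. ereal (g t \<bullet> \<nu>) + ereal (1 / \<eta>) * bregman h \<nu> (\<mu> t))
          (\<lambda>\<nu>. \<nu> \<in> ?D) (\<mu> (t + 1))"
        using run unfolding dual_mirror_descent_run_def g_def b_def by blast
      show "infnorm (g t) \<le> bbar + abar"
        using infnorm_triangle[of "- b t" "a t"] b_bd(3)[OF t] a_bd[OF t] by (simp add: g_def infnorm_neg)
    qed
    have "real n * (\<eta> * (bbar + abar)\<^sup>2 / (2 * \<sigma>)) \<le> real T * (\<eta> * (bbar + abar)\<^sup>2 / (2 * \<sigma>))"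
      using n \<eta> \<sigma> by (intro mult_right_mono) auto
    with regret have regret': "(\<Sum>t=1..n. g t \<bullet> (\<mu> t - \<nu>))
        \<le> real T * (\<eta> * (bbar + abar)\<^sup>2 / (2 * \<sigma>)) + bregman_fin h \<nu> \<mu>0 / \<eta>"
      using run by (simp add: dual_mirror_descent_run_def)

    define F where "F = (\<lambda>t. reward (\<gamma> t) (y t) + p \<bullet> consumption (\<gamma> t) (y t) + r 0)"
    have F_early: "F t \<le> \<alpha> * (reward (\<gamma> t) (x t) + r (a t) + g t \<bullet> \<mu> t)" if "t \<in> {1..n}" for t
    proof -
      have t: "t \<in> {1..T}" using that n by auto
      have tS: "\<gamma> t \<in> S" using \<gamma> t by blast
      \<comment> \<open>Every iterate after the first is the minimizer chosen in the preceding
        period.\<close>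
      have "\<mu> t \<in> ?D"
      proof (cases "t = 1")
        case True then show ?thesis using run \<mu>0 by (simp add: dual_mirror_descent_run_def)
      next
        case False
        then have "t - 1 \<in> {1..T}" "t = (t - 1) + 1" using t by auto
        then show ?thesis using run unfolding dual_mirror_descent_run_def is_arg_min_def by metis
      qed
      then have "reward (\<gamma> t) (y t) + p \<bullet> consumption (\<gamma> t) (y t) + r 0
          \<le> \<alpha> * (reward (\<gamma> t) (xt t) + r (a t) + (a t - consumption (\<gamma> t) (xt t)) \<bullet> \<mu> t)"
        using sup tS y(1) t req run
        by (intro per_period_bound[where S = S and \<rho> = \<rho>, OF _ \<alpha>])
          (auto simp: request_assms_def dual_mirror_descent_run_def)
      then show ?thesis by (simp add: F_def g_def b_def n(2)[OF that])
    qed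
    have F_late: "F t \<le> fbar + l1_norm p * bbar + rbar" if "t \<in> {1..T}" for t
    proof -
      have "\<gamma> t \<in> S" "y t \<in> decisions (\<gamma> t)" using \<gamma> y that by auto
      note bd = request_assmsD[OF req this]
      have "p \<bullet> consumption (\<gamma> t) (y t) \<le> infnorm (consumption (\<gamma> t) (y t)) * l1_norm p"
        by (subst inner_commute) (rule inner_le_infnorm_l1_norm)
      also have "\<dots> \<le> bbar * l1_norm p" using bd(5) p0 by (intro mult_right_mono)
      finally show ?thesis using bd(2) rbar by (simp add: F_def mult.commute)
    qed
    have split: "(\<Sum>t=1..T. f t) = (\<Sum>t=1..n. f t) + (\<Sum>t=n+1..T. f t)" for f :: "nat \<Rightarrow> real"
      using n(1) sum.ub_add_nat[of 1 n f "T - n"] by simp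

    \<comment> \<open>The supergradient \<open>p\<close> at 0 linearizes the regularizer, which
      distributes its value at the average over the periods.\<close>
    have y_le: "reg_reward r T \<gamma> y \<le> (\<Sum>t=1..T. F t)"
    proof -
      define v where "v = (1 / real T) *\<^sub>R (\<Sum>t=1..T. consumption (\<gamma> t) (y t))"
      have sum_v: "(\<Sum>t=1..T. consumption (\<gamma> t) (y t)) = real T *\<^sub>R v" using T by (simp add: v_def)
      then have "v \<le> \<rho>" using y(2) T unfolding sum_v by (simp add: less_eq_vec_def)
      then have "real T * r v \<le> real T * (r 0 + p \<bullet> v)"
        using p by (intro mult_left_mono) (auto simp: superdifferential_def)
      moreover have "(\<Sum>t=1..T. p \<bullet> consumption (\<gamma> t) (y t)) = real T * (p \<bullet> v)"
        unfolding inner_sum_right[symmetric] sum_v by simp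
      moreover have "reg_reward r T \<gamma> y = (\<Sum>t=1..T. reward (\<gamma> t) (y t)) + real T * r v"
        by (simp only: reg_reward_def v_def)
      ultimately show ?thesis by (simp add: F_def sum.distrib distrib_left)
    qed
    have late: "(\<Sum>t=n+1..T. F t) \<le> real (T - n) * (fbar + l1_norm p * bbar + rbar)"
      using sum_bounded_above[of "{n+1..T}" F] F_late by auto
    have x_ge: "(\<Sum>t=1..n. reward (\<gamma> t) (x t)) + real T * r av \<le> reg_reward r T \<gamma> x"
    proof -
      have "0 \<le> (\<Sum>t=n+1..T. reward (\<gamma> t) (x t))"
        using request_assmsD(1)[OF req _ x_dec] \<gamma> by (intro sum_nonneg) auto
      then show ?thesis using split[of "\<lambda>t. reward (\<gamma> t) (x t)"]
        by (simp add: reg_reward_def av_def b_def)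
    qed
    have "(\<Sum>t=1..n. r (a t) + g t \<bullet> \<nu>)
        \<le> real T * r av + real (T - n) * (L * bbar) + \<kappa> * (real n * \<rho> $ j - (\<Sum>t=1..n. b t $ j))"
    proof -
      \<comment> \<open>The choice of \<open>q\<close> replaces \<open>r (a t)\<close> by
        \<open>r av\<close>, and the constraint \<open>a t \<le> \<rho>\<close> bounds the term in
        \<open>\<kappa>\<close>.\<close>
      have "(\<Sum>t=1..n. r (a t) + g t \<bullet> \<nu>)
          \<le> (\<Sum>t=1..n. r av - q \<bullet> (b t - av) + \<kappa> * (\<rho> $ j - b t $ j))"
      proof (rule sum_mono)
        fix t assume "t \<in> {1..n}"
        then have a: "a t \<le> \<rho>" using run n(1) by (auto simp: dual_mirror_descent_run_def is_arg_max_def)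
        then have "\<kappa> * a t $ j \<le> \<kappa> * \<rho> $ j" using \<kappa> by (auto simp: less_eq_vec_def mult_left_mono)
        moreover have "g t \<bullet> \<nu> = q \<bullet> a t - q \<bullet> b t + \<kappa> * a t $ j - \<kappa> * b t $ j"
          by (subst inner_commute) (simp add: g_def \<nu>_def inner_add_left inner_add_right inner_axis' algebra_simps)
        ultimately show "r (a t) + g t \<bullet> \<nu> \<le> r av - q \<bullet> (b t - av) + \<kappa> * (\<rho> $ j - b t $ j)"
          using q(2)[OF a] by (simp add: inner_diff_right right_diff_distrib)
      qed
      also have "\<dots> = real n * r av - (\<Sum>t=1..n. q \<bullet> (b t - av))
          + \<kappa> * (real n * \<rho> $ j - (\<Sum>t=1..n. b t $ j))"
        by (simp add: sum.distrib sum_subtractf sum_distrib_left right_diff_distrib)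
      finally have 0: "(\<Sum>t=1..n. r (a t) + g t \<bullet> \<nu>) \<le> real n * r av - (\<Sum>t=1..n. q \<bullet> (b t - av))
          + \<kappa> * (real n * \<rho> $ j - (\<Sum>t=1..n. b t $ j))" .
      \<comment> \<open>The deviations from the average sum to zero over all periods, so those up to
        \<open>n\<close> are moved to the later periods. There each costs at most
        \<open>L * bbar\<close>, since the coordinates of \<open>b t\<close> and \<open>av\<close>
        both lie between 0 and \<open>bbar\<close>.\<close>
      have "- (\<Sum>t=1..n. q \<bullet> (b t - av)) = (\<Sum>t=n+1..T. q \<bullet> (b t - av))"
      proof -
        have "(\<Sum>t=1..T. q \<bullet> (b t - av)) = q \<bullet> ((\<Sum>t=1..T. b t) - real T *\<^sub>R av)"
          unfolding inner_sum_right[symmetric] by (simp add: sum_subtractf sum_constant_scaleR del: sum_constant)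
        then have "(\<Sum>t=1..T. q \<bullet> (b t - av)) = 0" unfolding sum_b by simp
        then show ?thesis using split[of "\<lambda>t. q \<bullet> (b t - av)"] by linarith
      qed
      with 0 have 1: "(\<Sum>t=1..n. r (a t) + g t \<bullet> \<nu>) \<le> real n * r av + (\<Sum>t=n+1..T. q \<bullet> (b t - av))
          + \<kappa> * (real n * \<rho> $ j - (\<Sum>t=1..n. b t $ j))" by linarith
      have "q \<bullet> (b t - av) \<le> L * bbar" if "t \<in> {n+1..T}" for t
      proof -
        have t: "t \<in> {1..T}" using that by auto
        have "infnorm (b t - av) \<le> bbar"
        proof (rule infnorm_le_cart)
          fix i show "\<bar>(b t - av) $ i\<bar> \<le> bbar" using b_bd(1,2)[OF t, of i] av_bd[of i] by simp
        qed
        then have "infnorm (b t - av) * l1_norm q \<le> bbar * L"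
          using q(1) bbar l1_norm_nonneg by (intro mult_mono) auto
        then show ?thesis
          using inner_le_infnorm_l1_norm[of "b t - av" q] by (simp add: inner_commute mult.commute)
      qed
      then have 2: "(\<Sum>t=n+1..T. q \<bullet> (b t - av)) \<le> real (T - n) * (L * bbar)"
        using sum_bounded_above[of "{n+1..T}" "\<lambda>t. q \<bullet> (b t - av)"] by auto
      \<comment> \<open>Nonnegativity of \<open>r\<close> at \<open>av\<close> allows its factor
        \<open>n\<close> to be raised to \<open>T\<close>.\<close>
      have "0 \<le> r av" using r_bd[of av] av_le av_bd by (simp add: less_eq_vec_def)
      then have "real n * r av \<le> real T * r av" using n(1) by (simp add: mult_right_mono)
      with 1 2 show ?thesis by linarith
    qed
    from mult_left_mono[OF this, of \<alpha>] have early: "\<alpha> * (\<Sum>t=1..n. r (a t) + g t \<bullet> \<nu>)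
        \<le> \<alpha> * (real T * r av) + \<alpha> * (real (T - n) * (L * bbar))
          + \<alpha> * (\<kappa> * (real n * \<rho> $ j - (\<Sum>t=1..n. b t $ j)))"
      using \<alpha> by (simp add: distrib_left)
    have slack: "real (T - n) * (fbar + l1_norm p * bbar + rbar) + \<alpha> * (real (T - n) * (L * bbar))
        \<le> real (T - n) * (K * \<rho>min)"
    proof -
      have "l1_norm p * bbar \<le> \<alpha> * (l1_norm p * bbar)" "0 \<le> \<alpha> * (l1_norm p * bbar)" "0 \<le> \<alpha> * (L * abar)"
        using \<alpha> p0 bbar abar L mult_right_mono[of 1 \<alpha> "l1_norm p * bbar"] by auto
      then have "fbar + l1_norm p * bbar + rbar + \<alpha> * (L * bbar) \<le> K * \<rho>min"
        unfolding K_eq by (simp add: algebra_simps)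
      from mult_left_mono[OF this, of "real (T - n)"] show ?thesis by (simp add: algebra_simps)
    qed
    have "(\<Sum>t=1..n. F t) \<le> (\<Sum>t=1..n. \<alpha> * (reward (\<gamma> t) (x t) + r (a t) + g t \<bullet> \<mu> t))"
      by (intro sum_mono F_early)
    also have "\<dots> = \<alpha> * (\<Sum>t=1..n. reward (\<gamma> t) (x t)) + \<alpha> * (\<Sum>t=1..n. r (a t) + g t \<bullet> \<nu>)
        + \<alpha> * (\<Sum>t=1..n. g t \<bullet> (\<mu> t - \<nu>))"
      by (simp add: inner_diff_right sum.distrib sum_subtractf distrib_left right_diff_distrib flip: sum_distrib_left)
    \<comment> \<open>The cost of the periods after \<open>n\<close>, bounded in
      \<open>slack\<close>, cancels against the negative term of \<open>gain\<close>; only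
      \<open>bbar * K\<close> survives.\<close>
    finally have "(\<Sum>t=1..T. F t) \<le> \<alpha> * (\<Sum>t=1..n. reward (\<gamma> t) (x t)) + \<alpha> * (real T * r av)
        + bbar * K + \<alpha> * (\<Sum>t=1..n. g t \<bullet> (\<mu> t - \<nu>))"
      using split[of F] late early gain slack by linarith
    moreover have "\<alpha> * (\<Sum>t=1..n. g t \<bullet> (\<mu> t - \<nu>))
        \<le> \<alpha> * (real T * (\<eta> * (bbar + abar)\<^sup>2 / (2 * \<sigma>)) + bregman_fin h \<nu> \<mu>0 / \<eta>)"
      using regret' \<alpha> by (intro mult_left_mono) auto
    moreover have "\<alpha> * ((\<Sum>t=1..n. reward (\<gamma> t) (x t)) + real T * r av) \<le> \<alpha> * reg_reward r T \<gamma> x"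
      using x_ge \<alpha> by (intro mult_left_mono) auto
    ultimately show ?thesis using y_le by (simp add: algebra_simps)
  qed
  have "ereal (reg_reward r T \<gamma> y - \<alpha> * reg_reward r T \<gamma> x)
      \<le> ereal (bbar * K + \<alpha> * (bbar + abar)\<^sup>2 / (2 * \<sigma>) * \<eta> * real T)
        + ereal (\<alpha> / \<eta>) * bregman h \<nu> \<mu>0"
  proof (cases "h differentiable (at \<mu>0)")
    case True
    then show ?thesis using real_bound by (simp add: bregman_eq_fin)
  next
    case False
    then show ?thesis using \<alpha> \<eta> by (simp add: bregman_def)
  qed
  then show ?thesis using that \<nu>D \<nu>_norm by blast
qed

section \<open>The bound for the offline optimum\<close>

theorem theorem2:
  fixes \<rho> p \<mu>0 :: "real ^ 'm" and r h :: "real ^ 'm \<Rightarrow> real"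
    and S :: "('d::finite, 'm::finite) request set"
    and fbar bbar L abar rbar \<sigma> \<alpha> \<eta> \<rho>min K C1 C2 :: real and C3 :: ereal
    and T :: nat and \<gamma> :: "nat \<Rightarrow> ('d, 'm) request"
    and \<mu> B a :: "nat \<Rightarrow> real ^ 'm" and xt x :: "nat \<Rightarrow> real ^ 'd"
  assumes "\<forall>j. 0 < \<rho> $ j"
    and "request_assms S fbar bbar"
    and "regularizer_assms \<rho> r L abar rbar"
    and "reference_assms (dual_dom \<rho> r) h \<sigma>"
    and "\<alpha> \<ge> 1" and "p \<in> superdifferential \<rho> r 0"
    and "\<forall>\<nu>\<in>dual_dom \<rho> r.
           (SUP q\<in>S. SUP y\<in>decisions q. ereal ((\<nu> + p) \<bullet> consumption q y)) + ereal (r 0)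
             \<le> ereal \<alpha> * reg_conj \<rho> r (- \<nu>)"
    and "\<eta> > 0" and "\<mu>0 \<in> dual_dom \<rho> r"
    and "T \<ge> 1" and "\<forall>t\<in>{1..T}. \<gamma> t \<in> S"
    and "dual_mirror_descent_run \<rho> r abar h \<eta> \<mu>0 T \<gamma> \<mu> B xt x a"
  defines "\<rho>min \<equiv> Min (range (\<lambda>j. \<rho> $ j))"
    and "K \<equiv> (fbar + rbar + \<alpha> * L * (bbar + abar) + 2 * \<alpha> * l1_norm p * bbar) / \<rho>min"
    and "C1 \<equiv> bbar * K"
    and "C2 \<equiv> \<alpha> * (bbar + abar)\<^sup>2 / (2 * \<sigma>)"
    and "C3 \<equiv> ereal \<alpha> *
           (SUP \<nu>\<in>{\<nu> \<in> dual_dom \<rho> r. l1_norm \<nu> \<le> L + K / \<alpha>}. bregman h \<nu> \<mu>0)"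
  shows "OPT \<rho> r T \<gamma> - ereal (\<alpha> * reg_reward r T \<gamma> x)
           \<le> ereal (C1 + C2 * \<eta> * real T) + C3 / ereal \<eta>"
proof -
  let ?D = "dual_dom \<rho> r"
  let ?N = "{\<nu> \<in> ?D. l1_norm \<nu> \<le> L + K / \<alpha>}"
  let ?bound = "ereal (C1 + C2 * \<eta> * real T) + C3 / ereal \<eta>"
  \<comment> \<open>The reward of the algorithm is a real number and can be moved across the
    inequality even if \<open>C3\<close> is infinite. In this form the bound passes to the supremum
    over \<open>y\<close>.\<close>
  have bound: "ereal (reg_reward r T \<gamma> y) \<le> ?bound + ereal (\<alpha> * reg_reward r T \<gamma> x)"
    if y: "\<forall>t\<in>{1..T}. y t \<in> decisions (\<gamma> t)"
      "(\<Sum>t=1..T. consumption (\<gamma> t) (y t)) \<le> real T *\<^sub>R \<rho>" for y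
  proof -
    obtain \<nu> where \<nu>: "\<nu> \<in> ?D" "l1_norm \<nu> \<le> L + K / \<alpha>"
      "ereal (reg_reward r T \<gamma> y - \<alpha> * reg_reward r T \<gamma> x)
        \<le> ereal (C1 + C2 * \<eta> * real T) + ereal (\<alpha> / \<eta>) * bregman h \<nu> \<mu>0"
      using regret_against_feasible[OF assms(1-12) y]
      unfolding C1_def C2_def K_def \<rho>min_def by blast
    \<comment> \<open>The comparison point depends on the run and may vary with \<open>y\<close>. It
      stays in \<open>?N\<close>, so the supremum over that set gives one bound for all
      \<open>y\<close>.\<close>
    have "bregman h \<nu> \<mu>0 \<le> (SUP \<nu>\<in>?N. bregman h \<nu> \<mu>0)"
      using \<nu>(1,2) by (intro SUP_upper) auto
    then have "ereal (\<alpha> / \<eta>) * bregman h \<nu> \<mu>0 \<le> ereal (\<alpha> / \<eta>) * (SUP \<nu>\<in>?N. bregman h \<nu> \<mu>0)"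
      using \<open>\<alpha> \<ge> 1\<close> \<open>\<eta> > 0\<close> by (intro ereal_mult_left_mono) auto
    also have "\<dots> = C3 / ereal \<eta>"
    proof -
      have "ereal (\<alpha> / \<eta>) = ereal \<alpha> * inverse (ereal \<eta>)" using \<open>\<eta> > 0\<close> by (simp add: divide_inverse)
      then show ?thesis unfolding C3_def divide_ereal_def by (simp only: ac_simps)
    qed
    finally have "ereal (C1 + C2 * \<eta> * real T) + ereal (\<alpha> / \<eta>) * bregman h \<nu> \<mu>0 \<le> ?bound"
      by (rule add_left_mono)
    with \<nu>(3) have "ereal (reg_reward r T \<gamma> y) - ereal (\<alpha> * reg_reward r T \<gamma> x) \<le> ?bound"
      by simp
    then show ?thesis by (subst (asm) ereal_minus_le) auto
  qed
  have "OPT \<rho> r T \<gamma> \<le> ?bound + ereal (\<alpha> * reg_reward r T \<gamma> x)"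
    unfolding OPT_def by (intro SUP_least) (use bound in auto)
  then show ?thesis by (subst ereal_minus_le) auto
qed

end
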